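(* Let $\epsilon>0$. For all sufficiently large integers $n$ (depending on $\epsilon$), the following holds: for every integer $t$ with $t\ge n^{12+\epsilon}$ and $t\equiv 0 \pmod 4$, we have $P_n^t(0,0)>0$.
   Context: For an integer $n\ge 2$ put $d=\binom n2$ and define $Z:\{-1,1\}^n\to\{-1,1\}^d$ by $Z(y)=(y_iy_j)_{1\le i<j\le n}$. Let $M=\{Z(y): y\in\{-1,1\}^n\}$. Let $(X_t)_{t\ge 0}$ be the random walk on $\mathbb{Z}^d$ whose increments are independent and uniformly distributed on $M$, and let $P_n^t(x,y)=\Pr(X_t=y\mid X_0=x)$ be its $t$-step transition probabilities. *)

theory Defs
  imports "HOL-Probability.Probability"
begin

text \<open>
  The coordinates of \<open>\<int>\<^sup>d\<close>, \<open>d = n choose 2\<close>, are indexed by the pairs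
  \<open>1 \<le> i < j \<le> n\<close>. A vector of \<open>\<int>\<^sup>d\<close> is a function on all pairs of naturals that
  vanishes outside the index set.
\<close>

definition index_pairs :: "nat \<Rightarrow> (nat \<times> nat) set" where
  "index_pairs n = {(i, j). 1 \<le> i \<and> i < j \<and> j \<le> n}"

definition lattice :: "nat \<Rightarrow> (nat \<times> nat \<Rightarrow> int) set" where
  "lattice n = {x. \<forall>p. p \<notin> index_pairs n \<longrightarrow> x p = 0}"

definition sign_vectors :: "nat \<Rightarrow> (nat \<Rightarrow> int) set" where
  "sign_vectors n = {1..n} \<rightarrow>\<^sub>E {-1, 1}"

definition Z :: "nat \<Rightarrow> (nat \<Rightarrow> int) \<Rightarrow> (nat \<times> nat \<Rightarrow> int)" where
  "Z n y = (\<lambda>(i, j). if (i, j) \<in> index_pairs n then y i * y j else 0)"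

definition M :: "nat \<Rightarrow> (nat \<times> nat \<Rightarrow> int) set" where
  "M n = Z n ` sign_vectors n"

definition increments :: "nat \<Rightarrow> (nat \<Rightarrow> nat \<times> nat \<Rightarrow> int) measure" where
  "increments n = (\<Pi>\<^sub>M s\<in>(UNIV :: nat set). uniform_count_measure (M n))"

definition walk ::
    "(nat \<times> nat \<Rightarrow> int) \<Rightarrow> (nat \<Rightarrow> nat \<times> nat \<Rightarrow> int) \<Rightarrow> nat \<Rightarrow> (nat \<times> nat \<Rightarrow> int)" where
  "walk x \<xi> t = (\<lambda>p. x p + (\<Sum>s<t. \<xi> s p))"

text \<open>
  Conditioning on \<open>X\<^sub>0 = x\<close> is rendered by starting the walk deterministically at \<open>x\<close>.
\<close>

definition trans_prob ::
    "nat \<Rightarrow> nat \<Rightarrow> (nat \<times> nat \<Rightarrow> int) \<Rightarrow> (nat \<times> nat \<Rightarrow> int) \<Rightarrow> real" where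
  "trans_prob n t x y = \<P>(\<xi> in increments n. walk x \<xi> t = y)"

lemma card_index_pairs: "card (index_pairs n) = n choose 2"
proof -
  have "index_pairs n = (SIGMA i:{1..n}. {i<..n})"
    by (auto simp: index_pairs_def)
  hence "card (index_pairs n) = (\<Sum>i=1..n. n - i)"
    by simp
  also have "\<dots> = (\<Sum>i<n. i)"
    by (rule sum.reindex_bij_witness[of _ "\<lambda>i. n - i" "\<lambda>i. n - i"]) auto
  also have "\<dots> = n choose 2"
    by (induction n) (auto simp: choose_two numeral_2_eq_2)
  finally show ?thesis .
qed

lemma M_subset_lattice: "M n \<subseteq> lattice n"
  by (auto simp: M_def Z_def lattice_def)

lemma finite_M: "finite (M n)"
  by (simp add: M_def sign_vectors_def finite_PiE)

lemma M_nonempty: "M n \<noteq> {}"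
  by (simp add: M_def sign_vectors_def PiE_eq_empty_iff)

lemma prob_space_increments: "prob_space (increments n)"
  unfolding increments_def
  by (intro prob_space_PiM prob_space_uniform_count_measure finite_M M_nonempty)

lemma walk_event_measurable:
  "{\<xi> \<in> space (increments n). walk x \<xi> t = y} \<in> sets (increments n)"
proof -
  have comp: "(\<lambda>\<xi>. \<xi> s p) \<in> increments n \<rightarrow>\<^sub>M count_space (UNIV :: int set)" for s p
  proof -
    have "(\<lambda>\<xi>. \<xi> s) \<in> increments n \<rightarrow>\<^sub>M uniform_count_measure (M n)"
      unfolding increments_def by (rule measurable_component_singleton) simp
    moreover have "(\<lambda>f. f p) \<in> uniform_count_measure (M n) \<rightarrow>\<^sub>M count_space (UNIV :: int set)"
      by (simp add: measurable_def space_uniform_count_measure sets_uniform_count_measure)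
    ultimately show ?thesis
      by (rule measurable_compose)
  qed
  have walk: "(\<lambda>\<xi>. x p + (\<Sum>s<t. \<xi> s p)) \<in> increments n \<rightarrow>\<^sub>M count_space UNIV" for p
  proof (induction t)
    case 0
    show ?case by simp
  next
    case (Suc t)
    have "(\<lambda>\<xi>. (x p + (\<Sum>s<t. \<xi> s p)) + a) \<in> increments n \<rightarrow>\<^sub>M count_space UNIV" for a
      by (rule measurable_compose[OF Suc.IH]) simp
    from measurable_compose_countable[OF this comp[of t p]] show ?case
      by (simp add: add.assoc)
  qed
  hence "{\<xi> \<in> space (increments n). x p + (\<Sum>s<t. \<xi> s p) = y p} \<in> sets (increments n)" for p
    using measurable_sets[OF walk[of p], of "{y p}"]
    by (simp add: vimage_def Int_def conj_commute)
  hence "{\<xi> \<in> space (increments n). \<forall>p. x p + (\<Sum>s<t. \<xi> s p) = y p} \<in> sets (increments n)"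
    by (rule sets.sets_Collect_countable_All)
  thus ?thesis
    by (simp add: walk_def fun_eq_iff)
qed

end

theory Submission
  imports Defs "HOL-Number_Theory.Cong"
begin

text \<open>
  A path of \<open>t\<close> steps from \<open>0\<close> to \<open>0\<close> amounts to a matrix with \<open>n\<close> rows, \<open>t\<close> columns and
  entries \<open>\<plusminus>1\<close> whose rows are pairwise orthogonal: the columns are the sign vectors chosen by
  the walk, and coordinate \<open>(i, j)\<close> of the endpoint is the inner product of rows \<open>i\<close> and \<open>j\<close>.
  Call such a matrix partial Hadamard. A path that uses only steps of the walk has positive
  probability (\<open>trans_prob_pos_of_path\<close>), so it is enough to construct partial Hadamard matrices
  of every width \<open>t \<ge> n\<^sup>4\<close> divisible by four (\<open>partial_hadamard_exists\<close>).

  Writing partial Hadamard matrices side by side adds their widths. Hence two widths whose greatest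
  common divisor is four yield all large multiples of four, by the coin problem for two coprime
  denominations (\<open>coprime_combination\<close>). Sylvester's matrices provide a power of two.
  The other width has to be four times an odd number, polynomial in \<open>n\<close>. It is \<open>q + 1\<close> with
  \<open>q = 3^(3^m)\<close>, which is \<open>4\<close> modulo \<open>8\<close>. A Hadamard matrix of this order comes from the
  Paley construction, which borders a skew-symmetric matrix \<open>S\<close> of order \<open>q\<close> with the row
  sums and inner products of a quadratic character matrix (\<open>partial_hadamard_skew_core\<close>). By an
  idea of Turyn, such an \<open>S\<close> of order \<open>q\<close> yields one of order \<open>q\<^sup>3\<close> (\<open>skew_core_cube\<close>). Starting from order \<open>3\<close> and
  cubing, one meets an order between \<open>n\<close> and \<open>n\<^sup>3\<close>.
\<close>

section \<open>Partial Hadamard matrices\<close>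

text \<open>
  Rows and columns are indexed by arbitrary sets, so that juxtaposition, tensor products and
  borders can use sums, products and options as indices.
\<close>

definition orthogonal_rows :: "('a \<Rightarrow> 'b \<Rightarrow> int) \<Rightarrow> 'a set \<Rightarrow> 'b set \<Rightarrow> bool" where
  "orthogonal_rows r A C \<longleftrightarrow>
     (\<forall>i\<in>A. \<forall>k\<in>C. r i k \<in> {-1, 1}) \<and>
     (\<forall>i\<in>A. \<forall>j\<in>A. i \<noteq> j \<longrightarrow> (\<Sum>k\<in>C. r i k * r j k) = 0)"

definition partial_hadamard :: "nat \<Rightarrow> nat \<Rightarrow> bool" where
  "partial_hadamard n t \<longleftrightarrow> (\<exists>r. orthogonal_rows r {1..n} {..<t})"

lemma orthogonal_rowsI:
  assumes "\<And>i k. i \<in> A \<Longrightarrow> k \<in> C \<Longrightarrow> r i k \<in> {-1, 1}"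
    and "\<And>i j. i \<in> A \<Longrightarrow> j \<in> A \<Longrightarrow> i \<noteq> j \<Longrightarrow> (\<Sum>k\<in>C. r i k * r j k) = 0"
  shows "orthogonal_rows r A C"
  using assms by (simp add: orthogonal_rows_def)

lemma orthogonal_rows_sign:
  "orthogonal_rows r A C \<Longrightarrow> i \<in> A \<Longrightarrow> k \<in> C \<Longrightarrow> r i k = -1 \<or> r i k = 1"
  by (simp add: orthogonal_rows_def)

lemma orthogonal_rows_sum:
  "orthogonal_rows r A C \<Longrightarrow> i \<in> A \<Longrightarrow> j \<in> A \<Longrightarrow> i \<noteq> j \<Longrightarrow> (\<Sum>k\<in>C. r i k * r j k) = 0"
  by (simp add: orthogonal_rows_def)

lemma partial_hadamardI:
  assumes r: "orthogonal_rows r A C" and fin: "finite A" "finite C"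
    and card: "n \<le> card A" "card C = t"
  shows "partial_hadamard n t"
proof -
  obtain f where f: "inj_on f {1..n}" "f ` {1..n} \<subseteq> A"
    using card_le_inj[of "{1..n}" A] fin card by auto
  obtain g where g: "bij_betw g {..<t} C"
    using finite_same_card_bij[of "{..<t}" C] fin card by auto
  have fA: "f i \<in> A" if "i \<in> {1..n}" for i
    using f(2) that by auto
  have gC: "g k \<in> C" if "k \<in> {..<t}" for k
    using bij_betwE[OF g] that by auto
  have "(\<Sum>k<t. r (f i) (g k) * r (f j) (g k)) = 0" if "i \<in> {1..n}" "j \<in> {1..n}" "i \<noteq> j" for i j
  proof -
    have "f i \<noteq> f j"
      using inj_onD[OF f(1), of i j] that by auto
    then have "(\<Sum>k\<in>C. r (f i) k * r (f j) k) = 0"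
      by (rule orthogonal_rows_sum[OF r fA[OF that(1)] fA[OF that(2)]])
    then show ?thesis
      by (simp add: sum.reindex_bij_betw[OF g, of "\<lambda>k. r (f i) k * r (f j) k"])
  qed
  moreover have "r (f i) (g k) \<in> {-1, 1}" if "i \<in> {1..n}" "k \<in> {..<t}" for i k
    using orthogonal_rows_sign[OF r fA[OF that(1)] gC[OF that(2)]] by auto
  ultimately have "orthogonal_rows (\<lambda>i k. r (f i) (g k)) {1..n} {..<t}"
    by (simp add: orthogonal_rows_def)
  then show ?thesis
    unfolding partial_hadamard_def by blast
qed

lemma partial_hadamard_add:
  assumes "partial_hadamard n s" "partial_hadamard n t"
  shows "partial_hadamard n (s + t)"
proof -
  obtain u v where u: "orthogonal_rows u {1..n} {..<s}" and v: "orthogonal_rows v {1..n} {..<t}"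
    using assms by (auto simp: partial_hadamard_def)
  have "orthogonal_rows (\<lambda>i. case_sum (u i) (v i)) {1..n} ({..<s} <+> {..<t})"
  proof (rule orthogonal_rowsI)
    fix i k assume "i \<in> {1..n}" "k \<in> {..<s} <+> {..<t}"
    then show "case_sum (u i) (v i) k \<in> {-1, 1}"
      using orthogonal_rows_sign[OF u] orthogonal_rows_sign[OF v] by (elim PlusE) auto
  next
    fix i j assume "i \<in> {1..n}" "j \<in> {1..n}" "i \<noteq> j"
    then show "(\<Sum>k\<in>{..<s} <+> {..<t}. case_sum (u i) (v i) k * case_sum (u j) (v j) k) = 0"
      by (simp add: sum.Plus orthogonal_rows_sum[OF u] orthogonal_rows_sum[OF v])
  qed
  then show ?thesis
    by (rule partial_hadamardI) (auto simp: card_Plus)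
qed

lemma partial_hadamard_mult:
  assumes "partial_hadamard n t"
  shows "partial_hadamard n (c * t)"
proof (induction c)
  case 0
  then show ?case by (simp add: partial_hadamard_def orthogonal_rows_def)
next
  case (Suc c)
  then show ?case using partial_hadamard_add[OF assms Suc.IH] by simp
qed

text \<open>
  This is the tensor product with the Hadamard matrix of order two. Its inner products factor, and
  the factor from the small matrix vanishes when the two rows come from the same row \<open>i\<close>.
\<close>

lemma partial_hadamard_double:
  assumes "partial_hadamard n t"
  shows "partial_hadamard (2 * n) (2 * t)"
proof -
  obtain u where u: "orthogonal_rows u {1..n} {..<t}"
    using assms by (auto simp: partial_hadamard_def)
  let ?r = "\<lambda>(b, i) (c, k). (if b \<and> c then -1 else 1) * u i k"
  have sum: "(\<Sum>k\<in>UNIV \<times> {..<t}. ?r (b, i) k * ?r (b', j) k) = 0"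
    if "i \<in> {1..n}" "j \<in> {1..n}" "(b, i) \<noteq> (b', j)" for b b' i j
  proof -
    have "(\<Sum>k\<in>UNIV \<times> {..<t}. ?r (b, i) k * ?r (b', j) k)
      = (\<Sum>c\<in>UNIV. (if b \<and> c then -1 else 1) * (if b' \<and> c then -1 else 1))
        * (\<Sum>k<t. u i k * u j k)"
      unfolding sum_product sum.cartesian_product
      by (intro sum.cong) (auto simp: mult_ac)
    also have "\<dots> = 0"
      using that orthogonal_rows_sum[OF u, of i j]
      by (cases "i = j"; cases b; cases b') (simp_all add: UNIV_bool)
    finally show ?thesis .
  qed
  have sign: "?r i k \<in> {-1, 1}" if "i \<in> UNIV \<times> {1..n}" "k \<in> UNIV \<times> {..<t}" for i k
  proof -
    obtain b i' c k' where ik: "i = (b, i')" "k = (c, k')"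
      by (cases i, cases k)
    then have "u i' k' = -1 \<or> u i' k' = 1"
      using orthogonal_rows_sign[OF u, of i' k'] that by simp
    then show ?thesis by (auto simp: ik)
  qed
  have "orthogonal_rows ?r (UNIV \<times> {1..n}) (UNIV \<times> {..<t})"
  proof (rule orthogonal_rowsI)
    fix i j :: "bool \<times> nat"
    assume "i \<in> UNIV \<times> {1..n}" "j \<in> UNIV \<times> {1..n}" "i \<noteq> j"
    then show "(\<Sum>k\<in>UNIV \<times> {..<t}. ?r i k * ?r j k) = 0"
      using sum[of "snd i" "snd j" "fst i" "fst j"] by (cases i, cases j) simp
  qed (rule sign)
  then show ?thesis
    by (rule partial_hadamardI) (auto simp: card_cartesian_product)
qed

lemma partial_hadamard_mono:
  assumes "partial_hadamard n t" "m \<le> n"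
  shows "partial_hadamard m t"
proof -
  have "{1..m} \<subseteq> {1..n}" using assms(2) by simp
  with assms(1) show ?thesis
    unfolding partial_hadamard_def orthogonal_rows_def by blast
qed

lemma partial_hadamard_power_2: "partial_hadamard (2 ^ k) (2 ^ k)"
proof (induction k)
  case 0
  have "orthogonal_rows (\<lambda>i k. 1) {1..1::nat} {..<1::nat}"
    by (simp add: orthogonal_rows_def)
  then show ?case unfolding partial_hadamard_def by auto
next
  case (Suc k)
  then show ?case using partial_hadamard_double by simp
qed

section \<open>Skew cores and their cubes\<close>

text \<open>
  In matrix form, \<open>S\<^sup>T = - S\<close>, \<open>S J = 0\<close> and \<open>S S\<^sup>T = q I - J\<close>, where \<open>J\<close> is the all-ones matrix and
  \<open>q\<close> the order. Bordering \<open>S\<close> by signs gives a skew conference matrix. The model is \<open>S i j = \<chi> (i - j)\<close>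
  for the quadratic character \<open>\<chi>\<close> of a field with \<open>q \<equiv> 3 (mod 4)\<close> elements.
\<close>

definition skew_core :: "('a \<Rightarrow> 'a \<Rightarrow> int) \<Rightarrow> 'a set \<Rightarrow> bool" where
  "skew_core S A \<longleftrightarrow>
     (\<forall>i\<in>A. \<forall>j\<in>A. i \<noteq> j \<longrightarrow> S i j \<in> {-1, 1}) \<and>
     (\<forall>i\<in>A. \<forall>j\<in>A. S j i = - S i j) \<and>
     (\<forall>i\<in>A. (\<Sum>k\<in>A. S i k) = 0) \<and>
     (\<forall>i\<in>A. \<forall>j\<in>A. (\<Sum>k\<in>A. S i k * S j k) = int (card A) * of_bool (i = j) - 1)"

definition skew_core_order :: "nat \<Rightarrow> bool" where
  "skew_core_order q \<longleftrightarrow> (\<exists>S. skew_core S {..<q})"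

lemma skew_coreI:
  assumes "\<And>i j. i \<in> A \<Longrightarrow> j \<in> A \<Longrightarrow> i \<noteq> j \<Longrightarrow> S i j \<in> {-1, 1}"
    and "\<And>i j. i \<in> A \<Longrightarrow> j \<in> A \<Longrightarrow> S j i = - S i j"
    and "\<And>i. i \<in> A \<Longrightarrow> (\<Sum>k\<in>A. S i k) = 0"
    and "\<And>i j. i \<in> A \<Longrightarrow> j \<in> A \<Longrightarrow>
      (\<Sum>k\<in>A. S i k * S j k) = int (card A) * of_bool (i = j) - 1"
  shows "skew_core S A"
  unfolding skew_core_def by (intro conjI ballI impI assms)

lemma skew_core_sign:
  assumes "skew_core S A" "i \<in> A" "j \<in> A" "i \<noteq> j"
  shows "S i j = -1 \<or> S i j = 1"
  using assms unfolding skew_core_def by blast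

lemma skew_core_skew:
  assumes "skew_core S A" "i \<in> A" "j \<in> A"
  shows "S j i = - S i j"
  using assms unfolding skew_core_def by blast

lemma skew_core_row:
  assumes "skew_core S A" "i \<in> A"
  shows "(\<Sum>k\<in>A. S i k) = 0"
  using assms unfolding skew_core_def by blast

lemma skew_core_gram:
  assumes "skew_core S A" "i \<in> A" "j \<in> A"
  shows "(\<Sum>k\<in>A. S i k * S j k) = int (card A) * of_bool (i = j) - 1"
  using assms unfolding skew_core_def by blast

lemma skew_core_diag:
  assumes "skew_core S A" "i \<in> A"
  shows "S i i = 0"
  using skew_core_skew[OF assms(1,2,2)] by simp

lemma skew_core_orderI:
  assumes S: "skew_core S A" and "finite A" "card A = q"
  shows "skew_core_order q"
proof -
  obtain g where g: "bij_betw g {..<q} A"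
    using finite_same_card_bij[of "{..<q}" A] assms by auto
  have gA: "g i \<in> A" if "i \<in> {..<q}" for i
    using bij_betwE[OF g] that by auto
  have gi: "g i = g j \<longleftrightarrow> i = j" if "i \<in> {..<q}" "j \<in> {..<q}" for i j
    using inj_on_eq_iff[OF bij_betw_imp_inj_on[OF g] that] .
  have "skew_core (\<lambda>i j. S (g i) (g j)) {..<q}"
  proof (rule skew_coreI)
    fix i assume i: "i \<in> {..<q}"
    show "(\<Sum>k<q. S (g i) (g k)) = 0"
      using skew_core_row[OF S gA[OF i]] sum.reindex_bij_betw[OF g, of "S (g i)"] by simp
    fix j assume j: "j \<in> {..<q}"
    show "S (g j) (g i) = - S (g i) (g j)"
      by (rule skew_core_skew[OF S gA[OF i] gA[OF j]])
    show "(\<Sum>k<q. S (g i) (g k) * S (g j) (g k)) = int (card {..<q}) * of_bool (i = j) - 1"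
      using skew_core_gram[OF S gA[OF i] gA[OF j]] gi[OF i j] assms(3)
        sum.reindex_bij_betw[OF g, of "\<lambda>k. S (g i) k * S (g j) k"]
      by simp
    assume "i \<noteq> j"
    then show "S (g i) (g j) \<in> {-1, 1}"
      using skew_core_sign[OF S gA[OF i] gA[OF j]] gi[OF i j] by auto
  qed
  then show ?thesis unfolding skew_core_order_def by blast
qed

lemma skew_core_order_3: "skew_core_order 3"
proof -
  let ?S = "\<lambda>i j :: nat. if i = j then 0 else if j = (i + 1) mod 3 then 1 else -1 :: int"
  have "{..<3} = {0, 1, 2 :: nat}" by auto
  then have "skew_core ?S {..<3}" by (simp add: skew_core_def)
  then show ?thesis unfolding skew_core_order_def by blast
qed

text \<open>
  The triple product \<open>S a x * S b y * S c z\<close> vanishes as soon as the two triples agree somewhere, and the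
  first three terms repair exactly this. Go cyclically through the three coordinates: if the triples
  agree in some of them but not in all, there is exactly one place where a coordinate in which they
  differ is followed by one in which they agree, and the term that looks at this place is the only
  nonzero one.
\<close>

fun cube_core :: "('a \<Rightarrow> 'a \<Rightarrow> int) \<Rightarrow> 'a \<times> 'a \<times> 'a \<Rightarrow> 'a \<times> 'a \<times> 'a \<Rightarrow> int" where
  "cube_core S (a, b, c) (x, y, z) =
     S a x * of_bool (b = y) + S b y * of_bool (c = z) + S c z * of_bool (a = x)
     + S a x * S b y * S c z"

lemma sum_triple_product:
  fixes f g h :: "'a \<Rightarrow> int"
  shows "(\<Sum>(x, y, z)\<in>A \<times> A \<times> A. f x * g y * h z) = sum f A * sum g A * sum h A"
  by (simp flip: sum.cartesian_product sum_distrib_left sum_distrib_right)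

lemma sum_of_bool_eq_mult:
  fixes f :: "'a \<Rightarrow> int"
  assumes "finite A" "u \<in> A"
  shows "(\<Sum>x\<in>A. of_bool (u = x) * f x) = f u"
proof -
  have "(\<Sum>x\<in>A. of_bool (u = x) * f x) = (\<Sum>x\<in>A. if u = x then f x else 0)"
    by (rule sum.cong) auto
  also have "\<dots> = f u" using assms by (simp add: sum.delta')
  finally show ?thesis .
qed

lemma sum_mult_of_bool_eq:
  fixes f :: "'a \<Rightarrow> int"
  assumes "finite A" "u \<in> A"
  shows "(\<Sum>x\<in>A. f x * of_bool (u = x)) = f u"
  using sum_of_bool_eq_mult[OF assms, of f] by (simp add: mult.commute)

text \<open>
  Each product of two of the four terms of \<open>cube_core\<close> splits over the coordinates. For two
  different terms some coordinate contributes a row sum of \<open>S\<close>, which is zero. The four squares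
  contribute, with \<open>\<alpha>, \<beta>, \<gamma>\<close> the Kronecker deltas of the coordinates,
  \<open>q (q \<alpha> - 1) \<beta> + q (q \<beta> - 1) \<gamma> + q (q \<gamma> - 1) \<alpha> + (q \<alpha> - 1) (q \<beta> - 1) (q \<gamma> - 1)\<close>,
  and everything except \<open>q\<^sup>3 \<alpha> \<beta> \<gamma> - 1\<close> cancels.
\<close>

lemma cube_core_gram:
  assumes S: "skew_core S A" and fin: "finite A" and i: "i \<in> A \<times> A \<times> A" and j: "j \<in> A \<times> A \<times> A"
  shows "(\<Sum>k\<in>A \<times> A \<times> A. cube_core S i k * cube_core S j k) =
    int (card A) ^ 3 * of_bool (i = j) - 1"
proof -
  obtain a b c where ii: "i = (a, b, c)" "a \<in> A" "b \<in> A" "c \<in> A" using i by auto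
  obtain a' b' c' where jj: "j = (a', b', c')" "a' \<in> A" "b' \<in> A" "c' \<in> A" using j by auto
  define q where "q = int (card A)"
  define d :: "'a \<Rightarrow> 'a \<Rightarrow> int" where "d = (\<lambda>u v. of_bool (u = v))"
  have row: "(\<Sum>x\<in>A. S u x) = 0" if "u \<in> A" for u
    using skew_core_row[OF S that] .
  have gram: "(\<Sum>x\<in>A. S u x * S v x) = q * d u v - 1" if "u \<in> A" "v \<in> A" for u v
    using skew_core_gram[OF S that] by (simp add: q_def d_def)
  have delta: "(\<Sum>x\<in>A. d u x * f x) = f u" "(\<Sum>x\<in>A. f x * d u x) = f u"
    if "u \<in> A" for u and f :: "'a \<Rightarrow> int"
    using sum_of_bool_eq_mult[OF fin that] sum_mult_of_bool_eq[OF fin that] by (simp_all add: d_def)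
  have one: "(\<Sum>x\<in>A. d u x) = 1" if "u \<in> A" for u
    using delta(1)[OF that, of "\<lambda>_. 1"] by simp
  have sym: "d u v = d v u" for u v
    by (auto simp: d_def)
  have cube: "cube_core S (u, v, w) (x, y, z) =
      S u x * d v y + S v y * d w z + S w z * d u x + S u x * S v y * S w z" for u v w x y z
    by (simp add: d_def)
  \<comment> \<open>The sixteen products in blocks of four, one block for each term of \<open>cube_core S i k\<close>.\<close>
  let ?P = "\<lambda>f g h. (\<lambda>(x, y, z). f x * g y * h z :: int)"
  have "(\<Sum>k\<in>A \<times> A \<times> A. cube_core S i k * cube_core S j k) =
    (\<Sum>k\<in>A \<times> A \<times> A.
        ?P (\<lambda>x. S a x * S a' x) (\<lambda>y. d b y * d b' y) (\<lambda>z. 1) k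
      + ?P (\<lambda>x. S a x) (\<lambda>y. d b y * S b' y) (\<lambda>z. d c' z) k
      + ?P (\<lambda>x. S a x * d a' x) (\<lambda>y. d b y) (\<lambda>z. S c' z) k
      + ?P (\<lambda>x. S a x * S a' x) (\<lambda>y. d b y * S b' y) (\<lambda>z. S c' z) k
      + ?P (\<lambda>x. S a' x) (\<lambda>y. S b y * d b' y) (\<lambda>z. d c z) k
      + ?P (\<lambda>x. 1) (\<lambda>y. S b y * S b' y) (\<lambda>z. d c z * d c' z) k
      + ?P (\<lambda>x. d a' x) (\<lambda>y. S b y) (\<lambda>z. d c z * S c' z) k
      + ?P (\<lambda>x. S a' x) (\<lambda>y. S b y * S b' y) (\<lambda>z. d c z * S c' z) k
      + ?P (\<lambda>x. d a x * S a' x) (\<lambda>y. d b' y) (\<lambda>z. S c z) k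
      + ?P (\<lambda>x. d a x) (\<lambda>y. S b' y) (\<lambda>z. S c z * d c' z) k
      + ?P (\<lambda>x. d a x * d a' x) (\<lambda>y. 1) (\<lambda>z. S c z * S c' z) k
      + ?P (\<lambda>x. d a x * S a' x) (\<lambda>y. S b' y) (\<lambda>z. S c z * S c' z) k
      + ?P (\<lambda>x. S a x * S a' x) (\<lambda>y. S b y * d b' y) (\<lambda>z. S c z) k
      + ?P (\<lambda>x. S a x) (\<lambda>y. S b y * S b' y) (\<lambda>z. S c z * d c' z) k
      + ?P (\<lambda>x. S a x * d a' x) (\<lambda>y. S b y) (\<lambda>z. S c z * S c' z) k
      + ?P (\<lambda>x. S a x * S a' x) (\<lambda>y. S b y * S b' y) (\<lambda>z. S c z * S c' z) k)"
    by (rule sum.cong) (auto simp: ii jj cube distrib_left distrib_right ac_simps simp del: cube_core.simps)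
  also have "\<dots> = (q * d a a' - 1) * d b b' * q + q * (q * d b b' - 1) * d c c'
      + d a a' * q * (q * d c c' - 1)
      + (q * d a a' - 1) * (q * d b b' - 1) * (q * d c c' - 1)"
    using ii jj
    by (simp only: sum.distrib sum_triple_product)
       (simp add: row gram delta one sym[of a' a] sym[of b' b] sym[of c' c] flip: q_def)
  also have "\<dots> = q ^ 3 * (d a a' * d b b' * d c c') - 1"
    by (simp add: algebra_simps power3_eq_cube)
  also have "d a a' * d b b' * d c c' = of_bool (i = j)"
    by (simp add: ii jj d_def)
  finally show ?thesis by (simp add: q_def)
qed

lemma skew_core_cube:
  assumes S: "skew_core S A" and fin: "finite A"
  shows "skew_core (cube_core S) (A \<times> A \<times> A)"
proof (rule skew_coreI)
  fix i assume "i \<in> A \<times> A \<times> A"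
  then obtain a b c where i: "i = (a, b, c)" "a \<in> A" "b \<in> A" "c \<in> A" by auto
  let ?P = "\<lambda>f g h. (\<lambda>(x, y, z). f x * g y * h z :: int)"
  have "(\<Sum>k\<in>A \<times> A \<times> A. cube_core S i k) = (\<Sum>k\<in>A \<times> A \<times> A.
      ?P (S a) (\<lambda>y. of_bool (b = y)) (\<lambda>z. 1) k + ?P (\<lambda>x. 1) (S b) (\<lambda>z. of_bool (c = z)) k
    + ?P (\<lambda>x. of_bool (a = x)) (\<lambda>y. 1) (S c) k + ?P (S a) (S b) (S c) k)"
    by (rule sum.cong) (auto simp: i)
  also have "\<dots> = 0"
    using i by (simp only: sum.distrib sum_triple_product skew_core_row[OF S])
  finally show "(\<Sum>k\<in>A \<times> A \<times> A. cube_core S i k) = 0" .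
  fix j assume "j \<in> A \<times> A \<times> A"
  then obtain x y z where j: "j = (x, y, z)" "x \<in> A" "y \<in> A" "z \<in> A" by auto
  have "S x a = - S a x" "S y b = - S b y" "S z c = - S c z"
    using skew_core_skew[OF S] i j by blast+
  then show "cube_core S j i = - cube_core S i j"
    by (simp add: i(1) j(1) eq_commute[of x a] eq_commute[of y b] eq_commute[of z c])
  show "(\<Sum>k\<in>A \<times> A \<times> A. cube_core S i k * cube_core S j k) =
      int (card (A \<times> A \<times> A)) * of_bool (i = j) - 1"
    using cube_core_gram[OF S fin \<open>i \<in> _\<close> \<open>j \<in> _\<close>]
    by (simp add: card_cartesian_product power3_eq_cube mult.assoc)
  assume "i \<noteq> j"
  moreover have "a = x \<or> S a x = -1 \<or> S a x = 1" "b = y \<or> S b y = -1 \<or> S b y = 1"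
      "c = z \<or> S c z = -1 \<or> S c z = 1"
    using skew_core_sign[OF S] i j by blast+
  moreover have "S a a = 0" "S b b = 0" "S c c = 0"
    using skew_core_diag[OF S] i by auto
  ultimately show "cube_core S i j \<in> {-1, 1}"
    unfolding i(1) j(1) by auto
qed

lemma skew_core_order_cube:
  assumes "skew_core_order q"
  shows "skew_core_order (q ^ 3)"
proof -
  obtain S :: "nat \<Rightarrow> nat \<Rightarrow> int" where "skew_core S {..<q}"
    using assms by (auto simp: skew_core_order_def)
  from skew_core_cube[OF this] show ?thesis
    by (rule skew_core_orderI) (auto simp: card_cartesian_product power3_eq_cube)
qed

text \<open>
  Cubing preserves the residue \<open>3\<close> modulo \<open>8\<close>, which later makes \<open>(q + 1) / 4\<close> odd. The first
  order reached that is at least \<open>n\<close> is the cube of an order below \<open>n\<close>, unless it is \<open>3\<close> itself.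
\<close>

lemma skew_core_order_between:
  assumes "n \<ge> 2"
  shows "\<exists>q. skew_core_order q \<and> q mod 8 = 3 \<and> n \<le> q \<and> q \<le> n ^ 3"
proof -
  let ?q = "\<lambda>m. (3::nat) ^ (3 ^ m)"
  have core: "skew_core_order (?q m) \<and> ?q m mod 8 = 3" for m
  proof (induction m)
    case 0
    then show ?case using skew_core_order_3 by simp
  next
    case (Suc m)
    have "?q (Suc m) = ?q m ^ 3" by (simp add: power_mult[symmetric] mult.commute)
    moreover have "?q m ^ 3 mod 8 = 3"
      using Suc.IH power_mod[of "?q m" 8 3] by simp
    ultimately show ?case
      using Suc.IH skew_core_order_cube by metis
  qed
  have le_power: "l \<le> 3 ^ l" for l :: nat
    by (simp add: power_gt_expt less_imp_le)
  have "n \<le> ?q n"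
    using le_power[of n] le_power[of "3 ^ n"] by (rule order_trans)
  define m where "m = (LEAST m. n \<le> ?q m)"
  have m: "n \<le> ?q m" unfolding m_def by (rule LeastI[of _ n]) fact
  have "?q m \<le> n ^ 3"
  proof (cases m)
    case 0
    then show ?thesis using power_mono[OF assms, of 3] by simp
  next
    case (Suc l)
    then have "?q l < n" using not_less_Least[of l "\<lambda>m. n \<le> ?q m"] by (simp add: m_def)
    then have "?q l ^ 3 \<le> n ^ 3" by (intro power_mono) auto
    then show ?thesis by (simp add: Suc power_mult[symmetric] mult.commute)
  qed
  with core m show ?thesis by blast
qed

text \<open>
  The matrix is \<open>I + C\<close>, where \<open>C\<close> is \<open>S\<close> bordered by a first row of ones and a first column of
  minus ones, with \<open>0\<close> in the corner; the index \<open>None\<close> stands for the border. In the inner product of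
  two rows of \<open>S\<close>, the contribution of the border column cancels the \<open>-1\<close> from \<open>S S\<^sup>T = q I - J\<close>, and the two
  contributions \<open>S a b\<close> and \<open>S b a\<close> of the identity matrix cancel by skew symmetry.
\<close>

lemma partial_hadamard_skew_core:
  assumes "skew_core_order q"
  shows "partial_hadamard (Suc q) (Suc q)"
proof -
  obtain S :: "nat \<Rightarrow> nat \<Rightarrow> int" where S: "skew_core S {..<q}"
    using assms by (auto simp: skew_core_order_def)
  define r :: "nat option \<Rightarrow> nat option \<Rightarrow> int" where
    "r i k = (case i of None \<Rightarrow> 1 | Some a \<Rightarrow>
       (case k of None \<Rightarrow> -1 | Some x \<Rightarrow> S a x + of_bool (a = x)))" for i k
  let ?A = "insert None (Some ` {..<q})"
  have sum: "(\<Sum>k\<in>?A. f k) = f None + (\<Sum>x<q. f (Some x))" for f :: "nat option \<Rightarrow> int"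
    by (subst sum.insert) (auto simp: sum.reindex)
  have row: "(\<Sum>x<q. S a x) = 0" if "a < q" for a
    using skew_core_row[OF S] that by simp
  have delta: "(\<Sum>x<q. of_bool (a = x) * f x) = f a" "(\<Sum>x<q. f x * of_bool (a = x)) = f a"
    if "a < q" for a and f :: "nat \<Rightarrow> int"
    using that by (auto intro: sum_of_bool_eq_mult sum_mult_of_bool_eq)
  have one: "(\<Sum>x<q. of_bool (a = x)) = (1::int)" if "a < q" for a
    using delta(1)[OF that, of "\<lambda>_. 1"] by simp
  have first: "(\<Sum>k\<in>?A. r None k * r (Some a) k) = 0" if "a < q" for a
    using that by (simp add: sum r_def sum.distrib row one)
  have rest: "(\<Sum>k\<in>?A. r (Some a) k * r (Some b) k) = 0" if "a < q" "b < q" "a \<noteq> b" for a b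
  proof -
    have "(\<Sum>x<q. S a x * S b x) = -1" "S b a = - S a b"
      using skew_core_gram[OF S, of a b] skew_core_skew[OF S, of a b] that by simp_all
    then show ?thesis
      using that by (simp add: sum r_def sum.distrib distrib_left distrib_right delta del: of_bool_eq_iff)
  qed
  have "r i k \<in> {-1, 1}" if "i \<in> ?A" "k \<in> ?A" for i k
  proof -
    have "a = b \<or> S a b = -1 \<or> S a b = 1" if "a < q" "b < q" for a b
      using skew_core_sign[OF S, of a b] that by auto
    moreover have "S a a = 0" if "a < q" for a
      using skew_core_diag[OF S] that by simp
    ultimately show ?thesis
      using that by (cases i; cases k) (auto simp: r_def)
  qed
  moreover have "(\<Sum>k\<in>?A. r i k * r j k) = 0" if ij: "i \<in> ?A" "j \<in> ?A" "i \<noteq> j" for i j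
  proof (cases i)
    case None
    then show ?thesis using first ij by (cases j) auto
  next
    case i: (Some a)
    show ?thesis
    proof (cases j)
      case None
      then have "(\<Sum>k\<in>?A. r j k * r i k) = 0" using first i ij by auto
      then show ?thesis by (simp only: mult.commute)
    next
      case (Some b)
      then show ?thesis using rest[of a b] i ij by auto
    qed
  qed
  ultimately have "orthogonal_rows r ?A ?A"
    by (rule orthogonal_rowsI)
  then show ?thesis
    by (rule partial_hadamardI) (auto simp: card_image card_insert_if)
qed

section \<open>All sufficiently large multiples of four\<close>

text \<open>
  Since \<open>b\<close> is invertible modulo \<open>a\<close>, some \<open>y < a\<close> satisfies \<open>y * b \<equiv> s\<close>; then \<open>y * b\<close> does not exceed
  \<open>a * b \<le> s\<close>, and the remainder \<open>s - y * b\<close> is a multiple of \<open>a\<close>.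
\<close>

lemma coprime_combination:
  fixes a b s :: nat
  assumes "coprime a b" "0 < a" "a * b \<le> s"
  shows "\<exists>x y. s = x * a + y * b"
proof -
  obtain y0 where "[b * y0 = 1] (mod a)"
    using cong_solve_coprime_nat[of b a] assms(1) by (auto simp: coprime_commute)
  then have y0: "[b * (y0 * s) = s] (mod a)"
    using cong_scalar_right[of "b * y0" 1 a s] by (simp add: mult.assoc)
  define y where "y = (y0 * s) mod a"
  have "y < a" using assms by (simp add: y_def)
  then have "y * b \<le> s"
    using assms(3) mult_le_mono1[of y a b] by linarith
  moreover have "[y * b = s] (mod a)"
    using y0 by (simp add: y_def cong_def mod_mult_right_eq mult.commute)
  ultimately have "a dvd s - y * b"
    by (metis cong_altdef_nat cong_sym)
  then obtain x where "s - y * b = a * x" by blast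
  with \<open>y * b \<le> s\<close> have "s = x * a + y * b" by (simp add: mult.commute)
  then show ?thesis by blast
qed

text \<open>
  The widths \<open>2 ^ Suc k = 4 * 2 ^ j\<close> and \<open>q + 1 = 4 * m\<close>, with \<open>m\<close> odd, have greatest common divisor four.
  As \<open>2 ^ Suc k < 2 * n\<close> and \<open>q \<le> n\<^sup>3\<close>, the threshold \<open>4 * 2 ^ j * m\<close> of the coin problem
  is at most \<open>n\<^sup>4\<close>.
\<close>

lemma partial_hadamard_exists:
  assumes n: "n \<ge> 3" and t: "n ^ 4 \<le> t" "4 dvd t"
  shows "partial_hadamard n t"
proof -
  obtain q where q: "skew_core_order q" "q mod 8 = 3" "n \<le> q" "q \<le> n ^ 3"
    using skew_core_order_between[of n] n by auto
  define m where "m = Suc q div 4"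
  have m: "Suc q = 4 * m" "odd m" using q(2) unfolding m_def by presburger+
  obtain k where k: "2 ^ k < n" "n \<le> 2 ^ Suc k"
    using ex_power_ivl2[of 2 n] n by auto
  have "k \<noteq> 0" using k n by (cases k) auto
  then obtain j where j: "k = Suc j" by (cases k) auto
  obtain s where s: "t = 4 * s" using t(2) by blast
  have "4 * (2 ^ j * m) \<le> 2 ^ k * (2 * m)" by (simp add: j)
  also have "\<dots> \<le> n * n ^ 3"
  proof (rule mult_le_mono)
    have "2 * m \<le> q" using m(1) q(3) n by linarith
    then show "2 * m \<le> n ^ 3" using q(4) by linarith
  qed (use k in simp)
  also have "\<dots> \<le> 4 * s" using t(1) s by (simp add: power4_eq_xxxx power3_eq_cube mult.assoc)
  finally have "2 ^ j * m \<le> s" by simp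
  then obtain x y where xy: "s = x * 2 ^ j + y * m"
    using coprime_combination[of "2 ^ j" m s] m(2) by auto
  have "partial_hadamard n (2 ^ Suc k)"
    using partial_hadamard_mono[OF partial_hadamard_power_2 k(2)] .
  moreover have "partial_hadamard n (Suc q)"
    using partial_hadamard_mono[OF partial_hadamard_skew_core[OF q(1)]] q(3) by simp
  ultimately have "partial_hadamard n (x * 2 ^ Suc k + y * Suc q)"
    by (intro partial_hadamard_add partial_hadamard_mult)
  also have "x * 2 ^ Suc k + y * Suc q = t"
    unfolding s xy m(1) j by (simp add: algebra_simps)
  finally show ?thesis .
qed

section \<open>Return probabilities\<close>

text \<open>
  The increments that follow the given path for the first \<open>t\<close> steps form a cylinder set, whose
  probability is the \<open>t\<close>-th power of \<open>1 / card (M n)\<close>.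
\<close>

lemma trans_prob_pos_of_path:
  assumes v: "\<And>s. s < t \<Longrightarrow> v s \<in> M n" and walk: "walk x v t = y"
  shows "trans_prob n t x y > 0"
proof -
  interpret product_prob_space "\<lambda>_::nat. uniform_count_measure (M n)" UNIV
    by (intro product_prob_spaceI prob_space_uniform_count_measure finite_M M_nonempty)
  interpret I: prob_space "increments n" by (rule prob_space_increments)
  let ?E = "prod_emb UNIV (\<lambda>_. uniform_count_measure (M n)) {..<t} (\<Pi>\<^sub>E s\<in>{..<t}. {v s})"
  have "measure (increments n) ?E = (\<Prod>s<t. measure (uniform_count_measure (M n)) {v s})"
    unfolding increments_def
    by (rule measure_PiM_emb) (use v in \<open>auto simp: sets_uniform_count_measure\<close>)
  also have "\<dots> > 0"
    using v finite_M M_nonempty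
    by (intro prod_pos) (auto simp: measure_uniform_count_measure card_gt_0_iff)
  finally have "0 < measure (increments n) ?E" .
  also have "\<dots> \<le> trans_prob n t x y"
    unfolding trans_prob_def
  proof (rule I.finite_measure_mono[OF _ walk_event_measurable])
    show "?E \<subseteq> {\<xi> \<in> space (increments n). walk x \<xi> t = y}"
    proof
      fix \<xi> assume \<xi>: "\<xi> \<in> ?E"
      then have "\<xi> s = v s" if "s < t" for s
        using that by (auto simp: prod_emb_def PiE_iff restrict_def split: if_splits)
      then have "walk x \<xi> t = walk x v t" by (simp add: walk_def)
      moreover have "\<xi> \<in> space (increments n)"
        using \<xi> by (simp add: prod_emb_def increments_def space_PiM)
      ultimately show "\<xi> \<in> {\<xi> \<in> space (increments n). walk x \<xi> t = y}"
        using walk by simp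
    qed
  qed
  finally show ?thesis .
qed

text \<open>
  The walk takes the columns of the matrix as its sign vectors.
\<close>

lemma trans_prob_pos_of_partial_hadamard:
  assumes "partial_hadamard n t"
  shows "trans_prob n t (\<lambda>_. 0) (\<lambda>_. 0) > 0"
proof -
  obtain r where r: "orthogonal_rows r {1..n} {..<t}"
    using assms by (auto simp: partial_hadamard_def)
  define y where "y s = restrict (\<lambda>i. r i s) {1..n}" for s
  have "y s \<in> sign_vectors n" if "s < t" for s
    using orthogonal_rows_sign[OF r] that by (auto simp: sign_vectors_def y_def)
  then have "Z n (y s) \<in> M n" if "s < t" for s
    using that by (simp add: M_def)
  moreover have "(\<Sum>s<t. Z n (y s) p) = 0" for p
  proof (cases "p \<in> index_pairs n")
    case True
    then obtain i j where p: "p = (i, j)" "i \<in> {1..n}" "j \<in> {1..n}" "i \<noteq> j"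
      by (auto simp: index_pairs_def)
    then have "(\<Sum>s<t. Z n (y s) p) = (\<Sum>s<t. r i s * r j s)"
      using True by (intro sum.cong) (auto simp: Z_def y_def)
    also have "\<dots> = 0"
      by (rule orthogonal_rows_sum[OF r p(2-4)])
    finally show ?thesis .
  qed (cases p, simp add: Z_def)
  then have "walk (\<lambda>_. 0) (\<lambda>s. Z n (y s)) t = (\<lambda>_. 0)"
    by (auto simp: walk_def)
  ultimately show ?thesis
    by (rule trans_prob_pos_of_path)
qed

theorem theorem1:
  fixes \<epsilon> :: real
  assumes "\<epsilon> > 0"
  shows "\<forall>\<^sub>F n in sequentially.
    \<forall>t :: nat. real t \<ge> real n powr (12 + \<epsilon>) \<and> t mod 4 = 0 \<longrightarrow>
      trans_prob n t (\<lambda>_. 0) (\<lambda>_. 0) > 0"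
proof (rule eventually_sequentiallyI[of 3], intro allI impI)
  fix n t :: nat
  assume n: "3 \<le> n" and t: "real t \<ge> real n powr (12 + \<epsilon>) \<and> t mod 4 = 0"
  have "real (n ^ 4) = real n powr 4"
    using n by (simp add: powr_numeral)
  also have "\<dots> \<le> real n powr (12 + \<epsilon>)"
    using n assms by (intro powr_mono) auto
  also have "\<dots> \<le> real t" using t by simp
  finally have "n ^ 4 \<le> t" by linarith
  then show "trans_prob n t (\<lambda>_. 0) (\<lambda>_. 0) > 0"
    using n t by (intro trans_prob_pos_of_partial_hadamard partial_hadamard_exists) (auto simp: dvd_eq_mod_eq_0)
qed

end
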